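(* Let $\mathbb{F}$ be an arbitrary field and $p\in\mathbb{F}[x]$ a monic irreducible polynomial with $\deg(p)=s$. Let $G$ be the generalized Jordan matrix and $W$ the generalized Weyr matrix associated with $p$ and the generalized Segre characteristic $\alpha=(\alpha_1,\ldots,\alpha_m)$, and let $\tau=(\tau_1,\ldots,\tau_{\alpha_1})$ be the conjugate partition of $\alpha$. Then the dimensions over $\mathbb{F}$ of the centralizers are $$\dim(Z(G))=s\sum_{i=1}^m(2i-1)\alpha_i=\dim(Z(W))=s(\tau_1^2+\cdots+\tau_{\alpha_1}^2).$$
   Context: For a square matrix $A\in M_n(\mathbb{F})$, $Z(A)=\{B\in M_n(\mathbb{F}): AB=BA\}$ is the centralizer of $A$. Let $p=x^s+c_{s-1}x^{s-1}+\cdots+c_1x+c_0\in\mathbb{F}[x]$. Its companion matrix $C\in M_s(\mathbb{F})$ has ones on the first subdiagonal, last column $(-c_0,-c_1,\ldots,-c_{s-1})^T$, and zeros elsewhere. $E\in M_s(\mathbb{F})$ is the matrix whose only nonzero entry is a $1$ in position $(1,s)$. A generalized Segre characteristic is a sequence of integers $\alpha_1\ge\alpha_2\ge\cdots\ge\alpha_m\ge0$; its conjugate partition is $\tau=(\tau_1,\ldots,\tau_{\alpha_1})$, $\tau_i=\#\{j:\alpha_j\ge i\}$. The associated generalized Jordan matrix is $G=\mathrm{diag}(G_1,\ldots,G_m)$, where $G_i\in M_{s\alpha_i}(\mathbb{F})$ is the $\alpha_i\times\alpha_i$ block matrix with $s\times s$ blocks having $C$ in every diagonal block, $E$ in every block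 of the first block subdiagonal, and $0$ elsewhere. The associated generalized Weyr matrix is the $\alpha_1\times\alpha_1$ block upper bidiagonal matrix $W$ with diagonal blocks $W_i=\mathrm{diag}(C,\ldots,C)\in M_{s\tau_i}(\mathbb{F})$ ($i=1,\ldots,\alpha_1$), superdiagonal blocks (in block position $(i,i+1)$) $E_{i+1}=\begin{bmatrix}\mathrm{diag}(E,\ldots,E)\\0\end{bmatrix}\in M_{s\tau_i\times s\tau_{i+1}}(\mathbb{F})$ with $\tau_{i+1}$ copies of $E$ ($i=1,\ldots,\alpha_1-1$), and zeros elsewhere. *)

theory Defs
  imports "Jordan_Normal_Form.VS_Connect" "HOL-Computational_Algebra.Polynomial"
begin

definition mat_centralizer :: "'a :: field mat \<Rightarrow> 'a mat set" where
  "mat_centralizer A = {B \<in> carrier_mat (dim_row A) (dim_row A). A * B = B * A}"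

definition dim_centralizer :: "'a :: field mat \<Rightarrow> nat" where
  "dim_centralizer A = vectorspace.dim (class_ring :: 'a ring)
     (module_mat TYPE('a) (dim_row A) (dim_row A) \<lparr>carrier := mat_centralizer A\<rparr>)"

text \<open>Square block matrix with diagonal block sizes \<open>ns\<close>; the block in (0-based) block
  position \<open>(k, l)\<close> is \<open>B k l\<close>, of size \<open>ns ! k\<close> times \<open>ns ! l\<close>.\<close>

definition block_start :: "nat list \<Rightarrow> nat \<Rightarrow> nat" where
  "block_start ns k = sum_list (take k ns)"

definition block_index :: "nat list \<Rightarrow> nat \<Rightarrow> nat" where
  "block_index ns i = (LEAST k. i < block_start ns (Suc k))"

definition block_mat :: "nat list \<Rightarrow> (nat \<Rightarrow> nat \<Rightarrow> 'a mat) \<Rightarrow> 'a mat" where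
  "block_mat ns B = mat (sum_list ns) (sum_list ns) (\<lambda>(i, j).
     let k = block_index ns i; l = block_index ns j
     in B k l $$ (i - block_start ns k, j - block_start ns l))"

lemma block_index_eq:
  assumes "k < length ns" "a < ns ! k"
  shows "block_index ns (block_start ns k + a) = k"
  unfolding block_index_def
proof (rule Least_equality)
  show "block_start ns k + a < block_start ns (Suc k)"
    using assms by (simp add: block_start_def take_Suc_conv_app_nth)
next
  fix m assume m: "block_start ns k + a < block_start ns (Suc m)"
  show "k \<le> m"
  proof (rule ccontr)
    assume "\<not> k \<le> m"
    then obtain d where "k = Suc m + d" by (metis less_iff_Suc_add not_le add_Suc)
    then have "block_start ns (Suc m) \<le> block_start ns k"
      by (simp only: block_start_def take_add sum_list.append le_add1)
    with m show False by simp
  qed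
qed

lemma block_mat_index:
  assumes "k < length ns" "l < length ns" "a < ns ! k" "b < ns ! l"
  shows "block_mat ns B $$ (block_start ns k + a, block_start ns l + b) = B k l $$ (a, b)"
proof -
  have "block_start ns m + c < sum_list ns" if "m < length ns" "c < ns ! m" for m c
  proof -
    have "sum_list ns = block_start ns m + sum_list (drop m ns)"
      by (metis append_take_drop_id block_start_def sum_list.append)
    moreover have "sum_list (drop m ns) \<ge> ns ! m"
      using that by (simp add: Cons_nth_drop_Suc[symmetric])
    ultimately show ?thesis using that by simp
  qed
  with assms show ?thesis
    by (simp add: block_mat_def block_index_eq Let_def)
qed

text \<open>Matrix indices start at 0, so the corner position $(1,s)$ is \<open>(0, s - 1)\<close>.\<close>

definition companion_mat :: "'a :: field poly \<Rightarrow> 'a mat" where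
  "companion_mat p = mat (degree p) (degree p) (\<lambda>(i, j).
     if j = degree p - 1 then - coeff p i else if i = Suc j then 1 else 0)"

definition corner_mat :: "nat \<Rightarrow> 'a :: field mat" where
  "corner_mat s = mat s s (\<lambda>(i, j). if i = 0 \<and> j = s - 1 then 1 else 0)"

definition gen_segre_char :: "nat list \<Rightarrow> bool" where
  "gen_segre_char \<alpha> \<longleftrightarrow> \<alpha> \<noteq> [] \<and> sorted_wrt (\<ge>) \<alpha>"

definition conj_partition :: "nat list \<Rightarrow> nat list" where
  "conj_partition \<alpha> = map (\<lambda>i. card {j. j < length \<alpha> \<and> \<alpha> ! j \<ge> i}) [1..<Suc (hd \<alpha>)]"

definition gen_jordan_block :: "'a :: field poly \<Rightarrow> nat \<Rightarrow> 'a mat" where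
  "gen_jordan_block p a = block_mat (replicate a (degree p)) (\<lambda>k l.
     if k = l then companion_mat p
     else if k = Suc l then corner_mat (degree p)
     else 0\<^sub>m (degree p) (degree p))"

definition gen_jordan_mat :: "'a :: field poly \<Rightarrow> nat list \<Rightarrow> 'a mat" where
  "gen_jordan_mat p \<alpha> = diag_block_mat (map (gen_jordan_block p) \<alpha>)"

definition gen_weyr_mat :: "'a :: field poly \<Rightarrow> nat list \<Rightarrow> 'a mat" where
  "gen_weyr_mat p \<alpha> = (let s = degree p; \<tau> = conj_partition \<alpha> in
     block_mat (map (\<lambda>t. s * t) \<tau>) (\<lambda>k l.
       if k = l then diag_block_mat (replicate (\<tau> ! k) (companion_mat p))
       else if l = Suc k then
         diag_block_mat (replicate (\<tau> ! l) (corner_mat s))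
           @\<^sub>r 0\<^sub>m (s * (\<tau> ! k) - s * (\<tau> ! l)) (s * (\<tau> ! l))
       else 0\<^sub>m (s * (\<tau> ! k)) (s * (\<tau> ! l))))"

lemma gen_jordan_mat_square:
  "gen_jordan_mat p \<alpha> \<in> carrier_mat (degree p * sum_list \<alpha>) (degree p * sum_list \<alpha>)"
  unfolding gen_jordan_mat_def
  by (induction \<alpha>) (auto simp: Let_def gen_jordan_block_def block_mat_def sum_list_replicate algebra_simps)

lemma gen_weyr_mat_square:
  "gen_weyr_mat p \<alpha> \<in> carrier_mat (degree p * sum_list (conj_partition \<alpha>))
     (degree p * sum_list (conj_partition \<alpha>))"
  by (simp add: gen_weyr_mat_def Let_def block_mat_def sum_list_const_mult)

lemma mat_centralizer_subspace:
  fixes A :: "'a :: field mat"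
  assumes A: "A \<in> carrier_mat n n"
  shows "subspace class_ring (mat_centralizer A) (module_mat TYPE('a) n n)"
proof -
  interpret matrix_vs n n "TYPE('a)" .
  have "LinearCombinations.submodule class_ring (mat_centralizer A) V"
    unfolding LinearCombinations.submodule_def
    using A module_axioms
    by (auto simp: mat_centralizer_def module_mat_simps mult_add_distrib_mat add_mult_distrib_mat
        mult_smult_distrib mult_smult_assoc_mat)
  thus ?thesis by (simp add: subspace_def vectorspace_axioms)
qed

end

theory Submission
  imports Defs
begin

text \<open>
  The matrix \<open>G\<close> is the matrix of multiplication by \<open>x\<close> on the direct sum of the modules
  \<open>F[x]/(p^(\<alpha> ! i))\<close>, with respect to the basis of the elements \<open>x^a p^k\<close> of the \<open>i\<close>-th summand
  (\<open>k < \<alpha> ! i\<close>, \<open>a < s\<close>): the corner matrix \<open>E\<close> produces the carry \<open>x \<cdot> x^(s - 1) p^k = p^(k + 1) - \<dots>\<close>.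
  The matrix \<open>W\<close> describes the same map; only the basis is ordered by \<open>\<alpha> ! i - 1 - k\<close> first and by
  the summand \<open>i\<close> second. Both are therefore treated at once, as matrices whose rows and columns are
  labelled by the cells \<open>(i, k, a)\<close> through some bijection (locale \<open>gen_jordan_indexed\<close>, with the
  instances \<open>gen_jordan_mat_indexed\<close> and \<open>gen_weyr_mat_indexed\<close>).

  A matrix in the centralizer is a module endomorphism. It is determined by the images of the
  generators \<open>(j, 0, 0)\<close>, and the image of the \<open>j\<close>-th generator can be any vector killed by
  \<open>p^(\<alpha> ! j)\<close>. Multiplication by \<open>p\<close> just raises \<open>k\<close> by one (\<open>poly_mult_x\<close>), so these vectors form
  a coordinate subspace: the coordinates \<open>(i, k, a)\<close> with \<open>\<alpha> ! i \<le> k + \<alpha> ! j\<close> are arbitrary and the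
  others vanish. Hence certain entries of a centralizing matrix are free and determine all the
  others (\<open>centralizer_eq_0\<close>, \<open>centralizer_free\<close>), and the dimension is the number of these entries
  (\<open>dim_eq_card_free_entries\<close>), namely \<open>s\<close> times the sum of \<open>min (\<alpha> ! i) (\<alpha> ! j)\<close> over all pairs
  \<open>i\<close>, \<open>j\<close>. Summing these minima by the larger index gives the weights \<open>2 * i - 1\<close>, and cutting them
  into unit layers gives the squares of the conjugate partition.
\<close>

section \<open>Dimension as a number of free entries\<close>

text \<open>The matrices of \<open>Z\<close> with a single entry 1 among the positions \<open>P\<close> and 0 at the other
  positions of \<open>P\<close> form a basis, since the coefficients of a linear combination of them can be read
  off at \<open>P\<close>.\<close>

lemma dim_eq_card_free_entries:
  fixes Z :: "'a :: field mat set"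
  assumes Z: "subspace class_ring Z (module_mat TYPE('a) nr nc)"
    and P: "P \<subseteq> {..<nr} \<times> {..<nc}"
    and determined: "\<And>B. B \<in> Z \<Longrightarrow> (\<And>q. q \<in> P \<Longrightarrow> B $$ q = 0) \<Longrightarrow> B = 0\<^sub>m nr nc"
    and free: "\<And>f. \<exists>B\<in>Z. \<forall>q\<in>P. B $$ q = f q"
  shows "vectorspace.dim (class_ring :: 'a ring) (module_mat TYPE('a) nr nc \<lparr>carrier := Z\<rparr>) = card P"
proof -
  interpret matrix_vs nr nc "TYPE('a)" .
  \<comment> \<open>Linear combinations are formed in the subspace itself, where the dimension is taken; the entries
    of finite sums there are computed first.\<close>
  let ?W = "module_mat TYPE('a) nr nc \<lparr>carrier := Z\<rparr>"
  interpret W: vectorspace "class_ring :: 'a ring" ?W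
    using subspace_is_vs[OF Z] .
  have Wsimps: "carrier ?W = Z" "add ?W = (+)" "zero ?W = 0\<^sub>m nr nc" "module.smult ?W = (\<cdot>\<^sub>m)"
    by (simp_all add: module_mat_simps)
  have sub: "LinearCombinations.submodule class_ring Z V"
    using Z by (simp add: subspace_def)
  have Z_carrier: "B \<in> carrier_mat nr nc" if "B \<in> Z" for B
    using sub that by (auto simp: LinearCombinations.submodule_def module_mat_simps)
  have Z_smult: "c \<cdot>\<^sub>m B \<in> Z" if "B \<in> Z" for c B
    using W.smult_closed[of c B] that by (simp add: Wsimps class_ring_simps)
  have Z_add: "B + C \<in> Z" if "B \<in> Z" "C \<in> Z" for B C
    using W.M.add.m_closed[of B C] that by (simp add: Wsimps)
  have finP: "finite P" using P by (rule finite_subset) simp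
  have sum_entry: "finsum ?W g S \<in> Z \<and>
      (\<forall>i<nr. \<forall>j<nc. finsum ?W g S $$ (i, j) = (\<Sum>B\<in>S. g B $$ (i, j)))"
    if "finite S" "g \<in> S \<rightarrow> Z" for S g
    using that
  proof (induction S rule: finite_induct)
    case empty
    have "0\<^sub>m nr nc \<in> Z" using W.M.zero_closed by (simp add: Wsimps)
    then show ?case by (simp add: W.M.finsum_empty Wsimps)
  next
    case (insert B S)
    then have g: "g \<in> S \<rightarrow> carrier ?W" "g B \<in> carrier ?W" by (auto simp: Wsimps)
    have eq: "finsum ?W g (insert B S) = g B + finsum ?W g S"
      using W.M.finsum_insert[OF insert.hyps g] by (simp add: Wsimps)
    have IH: "finsum ?W g S \<in> Z" "\<forall>i<nr. \<forall>j<nc. finsum ?W g S $$ (i, j) = (\<Sum>B\<in>S. g B $$ (i, j))"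
      using insert by auto
    show ?case
      using IH g insert.hyps Z_add Z_carrier[of "g B"] Z_carrier[OF IH(1)]
      by (simp add: eq Wsimps)
  qed
  have lincomb_entry: "W.lincomb c S \<in> Z \<and>
      (\<forall>i<nr. \<forall>j<nc. W.lincomb c S $$ (i, j) = (\<Sum>B\<in>S. c B * B $$ (i, j)))"
    if "finite S" "S \<subseteq> Z" for c S
  proof -
    have "(\<lambda>B. c B \<cdot>\<^sub>m B) \<in> S \<rightarrow> Z" using that Z_smult by auto
    from sum_entry[OF that(1) this]
    have lc: "W.lincomb c S \<in> Z" "\<forall>i<nr. \<forall>j<nc.
        W.lincomb c S $$ (i, j) = (\<Sum>B\<in>S. (c B \<cdot>\<^sub>m B) $$ (i, j))"
      by (simp_all add: W.lincomb_def Wsimps)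
    have "(c B \<cdot>\<^sub>m B) $$ (i, j) = c B * B $$ (i, j)" if "B \<in> S" "i < nr" "j < nc" for B i j
      using Z_carrier[of B] \<open>S \<subseteq> Z\<close> that by auto
    with lc show ?thesis by simp
  qed
  obtain b where b: "\<And>q. q \<in> P \<Longrightarrow> b q \<in> Z"
      "\<And>q r. q \<in> P \<Longrightarrow> r \<in> P \<Longrightarrow> b q $$ r = of_bool (q = r)"
    using free[of "\<lambda>r. of_bool (q = r)" for q] by metis
  have inj: "inj_on b P"
    by (rule inj_onI) (metis b(2) of_bool_eq_iff)
  let ?S = "b ` P"
  have S: "finite ?S" "?S \<subseteq> Z" using finP b by auto
  have lincomb_P: "W.lincomb c ?S $$ r = c (b r)" if rP: "r \<in> P" for c r
  proof -
    obtain i j where r: "r = (i, j)" "i < nr" "j < nc" using subsetD[OF P rP] by (cases r) auto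
    have "W.lincomb c ?S $$ r = (\<Sum>q\<in>P. c (b q) * b q $$ r)"
      using lincomb_entry[OF S, of c] r by (simp add: sum.reindex[OF inj])
    also have "\<dots> = (\<Sum>q\<in>P. if q = r then c (b r) else 0)"
      by (rule sum.cong) (auto simp: b rP)
    finally show ?thesis using finP rP by simp
  qed
  have eqI: "B = C" if "B \<in> Z" "C \<in> Z" and agree: "\<And>q. q \<in> P \<Longrightarrow> B $$ q = C $$ q" for B C
  proof -
    have BC: "B \<in> carrier_mat nr nc" "C \<in> carrier_mat nr nc" using that Z_carrier by auto
    have "B + (- 1) \<cdot>\<^sub>m C \<in> Z" using that Z_add Z_smult by simp
    moreover have "(B + (- 1) \<cdot>\<^sub>m C) $$ q = 0" if q: "q \<in> P" for q
      using P q BC agree[OF q] by (cases q) auto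
    ultimately have "B + (- 1) \<cdot>\<^sub>m C = 0\<^sub>m nr nc" by (rule determined)
    then have "(B + (- 1) \<cdot>\<^sub>m C) $$ (i, j) = 0" if "i < nr" "j < nc" for i j
      using that by simp
    then show ?thesis using BC by (intro eq_matI) auto
  qed
  have "W.basis ?S"
  proof (subst W.basis_criterion)
    show "finite ?S" "?S \<subseteq> carrier ?W" using S by (auto simp: Wsimps)
    show "\<forall>v. v \<in> carrier ?W \<longrightarrow> (\<exists>!c. c \<in> ?S \<rightarrow>\<^sub>E carrier class_ring \<and> W.lincomb c ?S = v)"
    proof (intro allI impI)
      fix v assume "v \<in> carrier ?W"
      then have v: "v \<in> Z" by (simp add: Wsimps)
      let ?c = "restrict (\<lambda>B. v $$ inv_into P b B) ?S"
      have "W.lincomb ?c ?S = v"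
        using lincomb_entry[OF S] v by (intro eqI) (auto simp: lincomb_P inj)
      moreover have "c = ?c" if "c \<in> ?S \<rightarrow>\<^sub>E carrier class_ring" "W.lincomb c ?S = v" for c
      proof (rule PiE_ext[OF that(1)])
        show "?c \<in> ?S \<rightarrow>\<^sub>E carrier class_ring" by (auto simp: class_ring_simps)
        show "c B = ?c B" if "B \<in> ?S" for B
          using that lincomb_P[of _ c] \<open>W.lincomb c ?S = v\<close> by (auto simp: inj)
      qed
      ultimately show "\<exists>!c. c \<in> ?S \<rightarrow>\<^sub>E carrier class_ring \<and> W.lincomb c ?S = v"
        by (intro ex1I[of _ ?c]) (auto simp: class_ring_simps)
    qed
  qed
  then show ?thesis
    using W.dim_basis[OF S(1)] by (simp add: card_image inj)
qed

section \<open>Multiplication by \<open>x\<close> and by \<open>p\<close> in \<open>p\<close>-adic coordinates\<close>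

text \<open>A family \<open>f\<close> stands for the tuple of formal series with \<open>i\<close>-th component
  \<open>\<Sum>k a. f (i, k, a) x^a p^k\<close>. Leaving \<open>k\<close> unbounded means that nothing is reduced modulo a power
  of \<open>p\<close>; the reduction is postponed to the comparison with matrices. The carry from \<open>x^s p^k\<close> to
  \<open>p^(k + 1)\<close> is the case \<open>a = 0\<close>. If \<open>p\<close> is monic and \<open>f\<close> vanishes for
  \<open>a \<ge> degree p\<close>, then the two terms cancel at \<open>a = degree p\<close>, so the result has this property, too.\<close>

definition mult_x :: "'a :: field poly \<Rightarrow> (nat \<times> nat \<times> nat \<Rightarrow> 'a) \<Rightarrow> nat \<times> nat \<times> nat \<Rightarrow> 'a" where
  "mult_x p f = (\<lambda>(i, k, a).
     (if 0 < a then f (i, k, a - 1) else if 0 < k then f (i, k - 1, degree p - 1) else 0)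
     - coeff p a * f (i, k, degree p - 1))"

definition mult_p :: "(nat \<times> nat \<times> nat \<Rightarrow> 'a :: zero) \<Rightarrow> nat \<times> nat \<times> nat \<Rightarrow> 'a" where
  "mult_p f = (\<lambda>(i, k, a). if 0 < k then f (i, k - 1, a) else 0)"

text \<open>The cell \<open>(i, k, a)\<close> labels the basis element \<open>x^a p^k\<close> of the \<open>i\<close>-th summand.\<close>

definition cells :: "nat \<Rightarrow> nat list \<Rightarrow> (nat \<times> nat \<times> nat) set" where
  "cells s \<alpha> = (SIGMA i:{..<length \<alpha>}. {..<\<alpha> ! i} \<times> {..<s})"

definition gen_jordan_entry :: "'a :: field poly \<Rightarrow> nat \<times> nat \<times> nat \<Rightarrow> nat \<times> nat \<times> nat \<Rightarrow> 'a" where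
  "gen_jordan_entry p = (\<lambda>(i, k, a) (j, l, b).
     if i \<noteq> j then 0
     else if k = l then companion_mat p $$ (a, b)
     else if k = Suc l then corner_mat (degree p) $$ (a, b)
     else 0)"

lemma mem_cells [simp]: "(i, k, a) \<in> cells s \<alpha> \<longleftrightarrow> i < length \<alpha> \<and> k < \<alpha> ! i \<and> a < s"
  by (auto simp: cells_def)

lemma finite_cells [simp]: "finite (cells s \<alpha>)"
  by (simp add: cells_def)

lemma card_cells: "card (cells s \<alpha>) = s * sum_list \<alpha>"
  by (simp add: cells_def sum_list_sum_nth atLeast0LessThan sum_distrib_left mult.commute)

lemma mult_p_pow: "(mult_p ^^ t) f = (\<lambda>(i, k, a). if t \<le> k then f (i, k - t, a) else 0)"
  by (induction t) (auto simp: mult_p_def fun_eq_iff)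

lemma mult_p_mult_x: "mult_p (mult_x p f) = mult_x p (mult_p f)"
  by (auto simp: mult_p_def mult_x_def fun_eq_iff)

lemma mult_p_mult_x_pow: "mult_p ((mult_x p ^^ b) f) = (mult_x p ^^ b) (mult_p f)"
  by (induction b) (simp_all add: mult_p_mult_x)

lemma mult_x_sum:
  "mult_x p (\<lambda>u. \<Sum>r\<in>R. c r * g r u) = (\<lambda>u. \<Sum>r\<in>R. c r * mult_x p (g r) u)"
  by (auto simp: mult_x_def fun_eq_iff sum_distrib_left right_diff_distrib
      sum_subtractf sum_negf mult.left_commute)

lemma mult_x_pow_sum:
  "(mult_x p ^^ b) (\<lambda>u. \<Sum>r\<in>R. c r * g r u) = (\<lambda>u. \<Sum>r\<in>R. c r * (mult_x p ^^ b) (g r) u)"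
  by (induction b) (simp_all add: mult_x_sum)

lemma mult_p_pow_0: "(mult_p ^^ t) (\<lambda>_. 0) = (\<lambda>_. 0)"
  by (auto simp: mult_p_pow)

lemma mult_x_pow_0: "(mult_x p ^^ b) (\<lambda>_. 0) = (\<lambda>_. 0)"
  by (induction b) (auto simp: mult_x_def)

context
  fixes p :: "'a :: field poly"
  assumes monic: "lead_coeff p = 1" and degree_pos: "0 < degree p"
begin

lemma mult_x_monomial:
  assumes "Suc a < degree p"
  shows "mult_x p (\<lambda>u. of_bool (u = (i, k, a))) = (\<lambda>u. of_bool (u = (i, k, Suc a)))"
  using assms by (auto simp: mult_x_def fun_eq_iff)

lemma mult_x_pow_monomial:
  assumes "a < degree p"
  shows "(mult_x p ^^ a) (\<lambda>u. of_bool (u = (i, k, 0))) = (\<lambda>u. of_bool (u = (i, k, a)))"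
  using assms by (induction a) (simp_all add: mult_x_monomial)

text \<open>In powers of the operator, \<open>x^s \<cdot> p^k = p^(k + 1) - \<Sum>b<s. c_b x^b p^k\<close>: the powers below \<open>s\<close> only
  move the monomial along its block, and the last step yields the carry together with the last column
  of the companion matrix.\<close>

lemma poly_mult_x_monomial_0:
  "(mult_x p ^^ degree p) (\<lambda>u. of_bool (u = (i, k, 0))) v
     + (\<Sum>b<degree p. coeff p b * (mult_x p ^^ b) (\<lambda>u. of_bool (u = (i, k, 0))) v)
   = mult_p (\<lambda>u. of_bool (u = (i, k, 0))) v"
proof -
  obtain j l c where v: "v = (j, l, c)" by (metis prod_cases3)
  have "(mult_x p ^^ Suc (degree p - 1)) (\<lambda>u. of_bool (u = (i, k, 0)))
      = mult_x p (\<lambda>u. of_bool (u = (i, k, degree p - 1)))"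
    by (simp only: funpow.simps comp_apply) (simp add: mult_x_pow_monomial degree_pos)
  moreover have "Suc (degree p - 1) = degree p" using degree_pos by simp
  ultimately have top: "(mult_x p ^^ degree p) (\<lambda>u. of_bool (u = (i, k, 0)))
      = mult_x p (\<lambda>u. of_bool (u = (i, k, degree p - 1)))"
    using degree_pos by simp
  have "(\<Sum>b<degree p. coeff p b * (mult_x p ^^ b) (\<lambda>u. of_bool (u = (i, k, 0))) v)
      = (\<Sum>b<degree p. if b = c then (if j = i \<and> l = k then coeff p c else 0) else 0)"
    by (rule sum.cong) (auto simp: mult_x_pow_monomial v)
  also have "\<dots> = (if c < degree p \<and> j = i \<and> l = k then coeff p c else 0)"
    by simp
  finally have low: "(\<Sum>b<degree p. coeff p b * (mult_x p ^^ b) (\<lambda>u. of_bool (u = (i, k, 0))) v)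
      = (if c < degree p \<and> j = i \<and> l = k then coeff p c else 0)" .
  have "coeff p c = 1" if "degree p \<le> c" "c - Suc 0 = degree p - Suc 0"
  proof -
    have "c = degree p" using that degree_pos by linarith
    then show ?thesis using monic by simp
  qed
  then show ?thesis
    unfolding low using degree_pos
    by (auto simp: top v mult_x_def mult_p_def coeff_eq_0 not_less)
qed

text \<open>Since \<open>x^a p^k\<close> arises from \<open>p^k\<close> by an operator that commutes with both sides, the
  case \<open>a = 0\<close> carries over.\<close>

lemma poly_mult_x_monomial:
  assumes "a < degree p"
  shows "(mult_x p ^^ degree p) (\<lambda>u. of_bool (u = (i, k, a))) v
     + (\<Sum>b<degree p. coeff p b * (mult_x p ^^ b) (\<lambda>u. of_bool (u = (i, k, a))) v)
   = mult_p (\<lambda>u. of_bool (u = (i, k, a))) v"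
proof -
  define \<delta> :: "nat \<times> nat \<times> nat \<Rightarrow> 'a" where "\<delta> = (\<lambda>u. of_bool (u = (i, k, 0)))"
  have swap: "(mult_x p ^^ b) ((mult_x p ^^ a) \<delta>) = (mult_x p ^^ a) ((mult_x p ^^ b) \<delta>)" for b
    by (simp flip: funpow_add add: add.commute comp_apply[symmetric, of "mult_x p ^^ _"])
  have "(mult_x p ^^ a) (mult_p \<delta>)
      = (mult_x p ^^ a) (\<lambda>v. \<Sum>b\<le>degree p. coeff p b * (mult_x p ^^ b) \<delta> v)"
    using monic poly_mult_x_monomial_0[of i k]
    by (intro arg_cong[of _ _ "mult_x p ^^ a"] ext)
       (simp add: \<delta>_def lessThan_Suc_atMost[symmetric] add.commute)
  also have "\<dots> = (\<lambda>v. \<Sum>b\<le>degree p. coeff p b * (mult_x p ^^ b) ((mult_x p ^^ a) \<delta>) v)"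
    by (simp add: mult_x_pow_sum swap)
  finally have "mult_p ((mult_x p ^^ a) \<delta>) v
      = (\<Sum>b\<le>degree p. coeff p b * (mult_x p ^^ b) ((mult_x p ^^ a) \<delta>) v)"
    by (simp add: mult_p_mult_x_pow)
  then show ?thesis
    using monic assms
    by (simp add: \<delta>_def mult_x_pow_monomial lessThan_Suc_atMost[symmetric] add.commute)
qed

text \<open>Substituting \<open>mult_x\<close> into \<open>p\<close> gives \<open>mult_p\<close>, here solved for the top power. Finite support reduces
  this to monomials by linearity.\<close>

lemma poly_mult_x:
  assumes R: "finite R" "R \<subseteq> {(i, k, a). a < degree p}" and f: "\<And>u. u \<notin> R \<Longrightarrow> f u = 0"
  shows "(mult_x p ^^ degree p) f v
     = mult_p f v - (\<Sum>b<degree p. coeff p b * (mult_x p ^^ b) f v)"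
proof -
  let ?\<delta> = "\<lambda>r u. of_bool (u = r) :: 'a"
  have f_eq: "f = (\<lambda>u. \<Sum>r\<in>R. f r * ?\<delta> r u)"
    using R f by (auto simp: fun_eq_iff of_bool_def if_distrib[of "(*) _"] cong: if_cong)
  have p_eq: "mult_p f v = (\<Sum>r\<in>R. f r * mult_p (?\<delta> r) v)"
    by (subst f_eq) (auto simp: mult_p_def split: prod.splits)
  have x_eq: "(mult_x p ^^ b) f v = (\<Sum>r\<in>R. f r * (mult_x p ^^ b) (?\<delta> r) v)" for b
    by (subst f_eq, subst mult_x_pow_sum) simp
  have "mult_p (?\<delta> r) v = (mult_x p ^^ degree p) (?\<delta> r) v
      + (\<Sum>b<degree p. coeff p b * (mult_x p ^^ b) (?\<delta> r) v)" if "r \<in> R" for r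
    using poly_mult_x_monomial[of "snd (snd r)" "fst r" "fst (snd r)" v] that R(2)
    by (cases r) auto
  then have "mult_p f v = (\<Sum>r\<in>R. f r * (mult_x p ^^ degree p) (?\<delta> r) v)
      + (\<Sum>r\<in>R. \<Sum>b<degree p. coeff p b * (f r * (mult_x p ^^ b) (?\<delta> r) v))"
    unfolding p_eq
    by (simp add: distrib_left sum.distrib sum_distrib_left mult.left_commute)
  also have "(\<Sum>r\<in>R. \<Sum>b<degree p. coeff p b * (f r * (mult_x p ^^ b) (?\<delta> r) v))
      = (\<Sum>b<degree p. coeff p b * (mult_x p ^^ b) f v)"
    by (subst sum.swap) (simp add: x_eq sum_distrib_left)
  finally show ?thesis by (simp add: x_eq)
qed

text \<open>A row of the matrix reads only from cells with the same or a smaller \<open>k\<close>, so the untruncated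
  operator gives the same value.\<close>

lemma sum_gen_jordan_entry_row:
  assumes q: "q \<in> cells (degree p) \<alpha>"
  shows "(\<Sum>u\<in>cells (degree p) \<alpha>. gen_jordan_entry p q u * x u) = mult_x p x q"
proof -
  obtain i k a where q': "q = (i, k, a)" "i < length \<alpha>" "k < \<alpha> ! i" "a < degree p"
    using q by (cases q) auto
  have "gen_jordan_entry p q u * x u
      = (if u = (i, k, a - 1) then of_bool (0 < a) * x u else 0)
        + (if u = (i, k - 1, degree p - 1) then of_bool (a = 0 \<and> 0 < k) * x u else 0)
        - (if u = (i, k, degree p - 1) then coeff p a * x u else 0)"
    if "u \<in> cells (degree p) \<alpha>" for u
    using that q' degree_pos
    by (cases u) (auto simp: gen_jordan_entry_def companion_mat_def corner_mat_def)
  then have "(\<Sum>u\<in>cells (degree p) \<alpha>. gen_jordan_entry p q u * x u)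
      = of_bool (0 < a) * x (i, k, a - 1)
        + of_bool (a = 0 \<and> 0 < k) * x (i, k - 1, degree p - 1)
        - coeff p a * x (i, k, degree p - 1)"
    using q' degree_pos by (simp add: sum.distrib sum_subtractf)
  then show ?thesis using q' by (simp add: mult_x_def)
qed

text \<open>Truncation shows up here: the carry out of the last block \<open>k = \<alpha> ! j - 1\<close> is lost.\<close>

lemma sum_gen_jordan_entry_col:
  assumes r: "(j, k, a) \<in> cells (degree p) \<alpha>"
  shows "(\<Sum>u\<in>cells (degree p) \<alpha>. y u * gen_jordan_entry p u (j, k, a)) =
    (if Suc a < degree p then y (j, k, Suc a)
     else (if Suc k < \<alpha> ! j then y (j, Suc k, 0) else 0)
       - (\<Sum>b<degree p. coeff p b * y (j, k, b)))"
proof (cases "Suc a < degree p")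
  case True
  then have "y u * gen_jordan_entry p u (j, k, a) = (if u = (j, k, Suc a) then y u else 0)"
    if "u \<in> cells (degree p) \<alpha>" for u
    using that r
    by (cases u) (auto simp: gen_jordan_entry_def companion_mat_def corner_mat_def)
  then show ?thesis using True r by simp
next
  case False
  then have a: "a = degree p - 1" using r by auto
  let ?C = "(\<lambda>b. (j, k, b)) ` {..<degree p}"
  have C: "?C \<subseteq> cells (degree p) \<alpha>" using r by auto
  have "y u * gen_jordan_entry p u (j, k, a)
      = (if u = (j, Suc k, 0) then y u else 0)
        - (if u \<in> ?C then coeff p (snd (snd u)) * y u else 0)"
    if "u \<in> cells (degree p) \<alpha>" for u
    using that r degree_pos a
    by (cases u) (auto simp: gen_jordan_entry_def companion_mat_def corner_mat_def)
  then have "(\<Sum>u\<in>cells (degree p) \<alpha>. y u * gen_jordan_entry p u (j, k, a))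
      = (\<Sum>u\<in>cells (degree p) \<alpha>. if u = (j, Suc k, 0) then y u else 0)
        - (\<Sum>u\<in>cells (degree p) \<alpha>. if u \<in> ?C then coeff p (snd (snd u)) * y u else 0)"
    by (simp add: sum_subtractf)
  also have "(\<Sum>u\<in>cells (degree p) \<alpha>. if u = (j, Suc k, 0) then y u else 0)
      = (if Suc k < \<alpha> ! j then y (j, Suc k, 0) else 0)"
    using r degree_pos by simp
  also have "(\<Sum>u\<in>cells (degree p) \<alpha>. if u \<in> ?C then coeff p (snd (snd u)) * y u else 0)
      = (\<Sum>u\<in>?C. coeff p (snd (snd u)) * y u)"
    using C by (simp add: sum.inter_restrict[symmetric] Int_absorb1)
  also have "\<dots> = (\<Sum>b<degree p. coeff p b * y (j, k, b))"
    by (subst sum.reindex) (auto simp: inj_on_def)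
  finally show ?thesis using False by simp
qed

end

section \<open>The centralizer in cell coordinates\<close>

text \<open>The common shape of the generalized Jordan and Weyr matrices: the ordering \<open>e\<close> of the basis is
  left open.\<close>

locale gen_jordan_indexed =
  fixes p :: "'a :: field poly" and \<alpha> :: "nat list" and A :: "'a mat"
    and e :: "nat \<times> nat \<times> nat \<Rightarrow> nat"
  assumes monic: "lead_coeff p = 1" and degree_pos: "0 < degree p"
    and A_dim: "A \<in> carrier_mat (degree p * sum_list \<alpha>) (degree p * sum_list \<alpha>)"
    and e_bij: "bij_betw e (cells (degree p) \<alpha>) {..<degree p * sum_list \<alpha>}"
    and A_entry: "\<And>q r. q \<in> cells (degree p) \<alpha> \<Longrightarrow> r \<in> cells (degree p) \<alpha> \<Longrightarrow>
      A $$ (e q, e r) = gen_jordan_entry p q r"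
begin

abbreviation "n \<equiv> degree p * sum_list \<alpha>"
abbreviation "I \<equiv> cells (degree p) \<alpha>"

lemma e_less: "q \<in> I \<Longrightarrow> e q < n"
  using e_bij by (auto simp: bij_betw_def)

lemma e_inj: "q \<in> I \<Longrightarrow> r \<in> I \<Longrightarrow> e q = e r \<longleftrightarrow> q = r"
  using e_bij by (auto simp: bij_betw_def inj_on_def)

lemma e_surj:
  assumes "i < n" obtains q where "q \<in> I" "i = e q"
  using assms bij_betw_imp_surj_on[OF e_bij] by blast

lemma mult_entry:
  assumes "B \<in> carrier_mat n n" "C \<in> carrier_mat n n" "q \<in> I" "r \<in> I"
  shows "(B * C) $$ (e q, e r) = (\<Sum>u\<in>I. B $$ (e q, e u) * C $$ (e u, e r))"
proof -
  have "(B * C) $$ (e q, e r) = (\<Sum>k<n. B $$ (e q, k) * C $$ (k, e r))"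
    using assms e_less by (auto simp: scalar_prod_def atLeast0LessThan)
  also have "\<dots> = (\<Sum>u\<in>I. B $$ (e q, e u) * C $$ (e u, e r))"
    by (rule sum.reindex_bij_betw[OF e_bij, symmetric])
  finally show ?thesis .
qed

lemma mem_centralizer_iff:
  assumes B: "B \<in> carrier_mat n n"
  shows "B \<in> mat_centralizer A \<longleftrightarrow> (\<forall>q\<in>I. \<forall>j k a. (j, k, a) \<in> I \<longrightarrow>
    mult_x p (\<lambda>u. B $$ (e u, e (j, k, a))) q =
      (if Suc a < degree p then B $$ (e q, e (j, k, Suc a))
       else (if Suc k < \<alpha> ! j then B $$ (e q, e (j, Suc k, 0)) else 0)
         - (\<Sum>b<degree p. coeff p b * B $$ (e q, e (j, k, b)))))"
proof -
  have AB: "(A * B) $$ (e q, e r) = mult_x p (\<lambda>u. B $$ (e u, e r)) q" if "q \<in> I" "r \<in> I" for q r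
    using that A_entry
    by (simp add: mult_entry[OF A_dim B] sum_gen_jordan_entry_row[OF monic degree_pos, symmetric])
  have BA: "(B * A) $$ (e q, e (j, k, a)) =
      (if Suc a < degree p then B $$ (e q, e (j, k, Suc a))
       else (if Suc k < \<alpha> ! j then B $$ (e q, e (j, Suc k, 0)) else 0)
         - (\<Sum>b<degree p. coeff p b * B $$ (e q, e (j, k, b))))"
    if "q \<in> I" "(j, k, a) \<in> I" for q j k a
    using that sum_gen_jordan_entry_col[OF monic degree_pos that(2), of "\<lambda>u. B $$ (e q, e u)"]
      A_entry
    by (simp add: mult_entry[OF B A_dim])
  have "B \<in> mat_centralizer A \<longleftrightarrow> A * B = B * A"
    using A_dim B by (auto simp: mat_centralizer_def)
  also have "\<dots> \<longleftrightarrow> (\<forall>q\<in>I. \<forall>r\<in>I. (A * B) $$ (e q, e r) = (B * A) $$ (e q, e r))"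
  proof
    assume entries: "\<forall>q\<in>I. \<forall>r\<in>I. (A * B) $$ (e q, e r) = (B * A) $$ (e q, e r)"
    show "A * B = B * A"
    proof (rule eq_matI)
      fix i j assume "i < dim_row (B * A)" "j < dim_col (B * A)"
      then have "i < n" "j < n" using A_dim B by auto
      then show "(A * B) $$ (i, j) = (B * A) $$ (i, j)"
        using entries by (metis e_surj)
    qed (use A_dim B in auto)
  qed simp
  also have "\<dots> \<longleftrightarrow> (\<forall>q\<in>I. \<forall>j k a. (j, k, a) \<in> I \<longrightarrow>
      (A * B) $$ (e q, e (j, k, a)) = (B * A) $$ (e q, e (j, k, a)))"
    by (metis prod_cases3)
  finally show ?thesis
    using AB BA by simp
qed

text \<open>All cells from which \<open>mult_x\<close> reads at a cell of \<open>I\<close> lie in \<open>I\<close>, because \<open>I\<close> is closed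
  under decreasing \<open>k\<close> and under changing \<open>a\<close> below \<open>degree p\<close>.\<close>

lemma mult_x_cong:
  assumes "\<And>u. u \<in> I \<Longrightarrow> f u = g u" "q \<in> I"
  shows "mult_x p f q = mult_x p g q"
  using assms degree_pos by (cases q) (auto simp: mult_x_def)

lemma poly_mult_x_cells:
  assumes "\<And>u. u \<notin> I \<Longrightarrow> f u = 0"
  shows "(mult_x p ^^ degree p) ((mult_p ^^ k) f) v
     = (mult_p ^^ Suc k) f v - (\<Sum>b<degree p. coeff p b * (mult_x p ^^ b) ((mult_p ^^ k) f) v)"
proof -
  let ?R = "(\<lambda>(i, l, a). (i, l + k, a)) ` I"
  have "(mult_p ^^ k) f u = 0" if "u \<notin> ?R" for u
  proof (cases u)
    case (fields i l a)
    have "(i, l - k, a) \<notin> I" if "k \<le> l"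
    proof
      assume "(i, l - k, a) \<in> I"
      then have "(\<lambda>(i, l, a). (i, l + k, a)) (i, l - k, a) \<in> ?R" by (rule imageI)
      with \<open>u \<notin> ?R\<close> that show False by (simp add: fields)
    qed
    then show ?thesis using assms by (auto simp: mult_p_pow fields)
  qed
  moreover have "?R \<subseteq> {(i, k, a). a < degree p}" by auto
  ultimately show ?thesis
    using poly_mult_x[OF monic degree_pos, of ?R "(mult_p ^^ k) f" v] by simp
qed

text \<open>Commutation expresses each column through the preceding one, starting from the column of the
  generator \<open>(j, 0, 0)\<close>: one step to the right inside a block is \<open>mult_x\<close>, and passing from the end of
  block \<open>k\<close> to the next block amounts to applying \<open>p\<close> to the column \<open>(j, k, 0)\<close>. After the last block
  there is no next column, so \<open>p^(\<alpha> ! j)\<close> must kill the column of the generator.\<close>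

lemma centralizer_column:
  assumes B: "B \<in> mat_centralizer A" and j: "j < length \<alpha>" "0 < \<alpha> ! j" and q: "q \<in> I"
  defines "x \<equiv> \<lambda>u. if u \<in> I then B $$ (e u, e (j, 0, 0)) else 0"
  shows "k < \<alpha> ! j \<Longrightarrow> a < degree p \<Longrightarrow> B $$ (e q, e (j, k, a)) = (mult_x p ^^ a) ((mult_p ^^ k) x) q"
    and "(mult_p ^^ (\<alpha> ! j)) x q = 0"
proof -
  have B_dim: "B \<in> carrier_mat n n" using B A_dim by (auto simp: mat_centralizer_def)
  note comm = B[unfolded mem_centralizer_iff[OF B_dim], rule_format]
  have x_out: "x u = 0" if "u \<notin> I" for u using that by (simp add: x_def)
  have row: "\<forall>q\<in>I. \<forall>a<degree p. B $$ (e q, e (j, k, a)) = (mult_x p ^^ a) ((mult_p ^^ k) x) q"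
    if "k < \<alpha> ! j" "\<forall>q\<in>I. B $$ (e q, e (j, k, 0)) = (mult_p ^^ k) x q" for k
  proof -
    have "\<forall>q\<in>I. B $$ (e q, e (j, k, a)) = (mult_x p ^^ a) ((mult_p ^^ k) x) q"
      if "a < degree p" for a
      using that
    proof (induction a)
      case 0
      then show ?case using \<open>\<forall>q\<in>I. B $$ (e q, e (j, k, 0)) = _ q\<close> by simp
    next
      case (Suc a)
      show ?case
      proof
        fix q assume q: "q \<in> I"
        have "B $$ (e q, e (j, k, Suc a)) = mult_x p (\<lambda>u. B $$ (e u, e (j, k, a))) q"
          using comm[OF q, of j k a] j \<open>k < \<alpha> ! j\<close> Suc.prems by simp
        also have "\<dots> = mult_x p ((mult_x p ^^ a) ((mult_p ^^ k) x)) q"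
          using Suc q by (intro mult_x_cong) auto
        finally show "B $$ (e q, e (j, k, Suc a)) = (mult_x p ^^ Suc a) ((mult_p ^^ k) x) q"
          by simp
      qed
    qed
    then show ?thesis by blast
  qed
  have next_row: "(mult_p ^^ Suc k) x q = (if Suc k < \<alpha> ! j then B $$ (e q, e (j, Suc k, 0)) else 0)"
    if k: "k < \<alpha> ! j" "\<forall>q\<in>I. B $$ (e q, e (j, k, 0)) = (mult_p ^^ k) x q" and q: "q \<in> I" for k q
  proof -
    note row_k = row[OF k, rule_format]
    define d where "d = degree p - 1"
    have d: "degree p = Suc d" using degree_pos by (simp add: d_def)
    have "(mult_p ^^ Suc k) x q - (\<Sum>b<degree p. coeff p b * (mult_x p ^^ b) ((mult_p ^^ k) x) q)
        = mult_x p ((mult_x p ^^ d) ((mult_p ^^ k) x)) q"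
      using poly_mult_x_cells[of x k q, OF x_out] d by simp
    also have "\<dots> = mult_x p (\<lambda>u. B $$ (e u, e (j, k, d))) q"
      using q d by (intro mult_x_cong) (simp_all add: row_k)
    also have "\<dots> = (if Suc k < \<alpha> ! j then B $$ (e q, e (j, Suc k, 0)) else 0)
        - (\<Sum>b<degree p. coeff p b * (mult_x p ^^ b) ((mult_p ^^ k) x) q)"
    proof -
      have "(\<Sum>b<degree p. coeff p b * B $$ (e q, e (j, k, b)))
          = (\<Sum>b<degree p. coeff p b * (mult_x p ^^ b) ((mult_p ^^ k) x) q)"
        using q by (intro sum.cong) (simp_all add: row_k)
      then show ?thesis using comm[OF q, of j k d] j k(1) d by simp
    qed
    finally show ?thesis by simp
  qed
  have first: "\<forall>q\<in>I. B $$ (e q, e (j, k, 0)) = (mult_p ^^ k) x q" if "k < \<alpha> ! j" for k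
    using that
  proof (induction k)
    case 0
    then show ?case by (simp add: x_def)
  next
    case (Suc k)
    then show ?case using next_row[of k] by simp
  qed
  show "B $$ (e q, e (j, k, a)) = (mult_x p ^^ a) ((mult_p ^^ k) x) q"
    if "k < \<alpha> ! j" "a < degree p"
    using row[OF that(1) first] that q by blast
  show "(mult_p ^^ (\<alpha> ! j)) x q = 0"
    using next_row[of "\<alpha> ! j - 1" q] first[of "\<alpha> ! j - 1"] j q by simp
qed

text \<open>Conversely, columns generated in this way from vectors \<open>x j\<close> killed by \<open>p^(\<alpha> ! j)\<close> define a module
  endomorphism.\<close>

lemma mem_centralizerI:
  assumes out: "\<And>j u. u \<notin> I \<Longrightarrow> x j u = 0"
    and killed: "\<And>j q. q \<in> I \<Longrightarrow> j < length \<alpha> \<Longrightarrow> (mult_p ^^ (\<alpha> ! j)) (x j) q = 0"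
    and B_dim: "B \<in> carrier_mat n n"
    and B_entry: "\<And>q j k a. q \<in> I \<Longrightarrow> (j, k, a) \<in> I \<Longrightarrow>
      B $$ (e q, e (j, k, a)) = (mult_x p ^^ a) ((mult_p ^^ k) (x j)) q"
  shows "B \<in> mat_centralizer A"
  unfolding mem_centralizer_iff[OF B_dim]
proof (intro ballI allI impI)
  fix q j k a assume q: "q \<in> I" and r: "(j, k, a) \<in> I"
  have step: "mult_x p (\<lambda>u. B $$ (e u, e (j, k, a))) q = (mult_x p ^^ Suc a) ((mult_p ^^ k) (x j)) q"
  proof -
    have "mult_x p (\<lambda>u. B $$ (e u, e (j, k, a))) q
        = mult_x p ((mult_x p ^^ a) ((mult_p ^^ k) (x j))) q"
      using r q by (intro mult_x_cong) (simp_all only: B_entry)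
    then show ?thesis by simp
  qed
  show "mult_x p (\<lambda>u. B $$ (e u, e (j, k, a))) q =
      (if Suc a < degree p then B $$ (e q, e (j, k, Suc a))
       else (if Suc k < \<alpha> ! j then B $$ (e q, e (j, Suc k, 0)) else 0)
         - (\<Sum>b<degree p. coeff p b * B $$ (e q, e (j, k, b))))"
  proof (cases "Suc a < degree p")
    case True
    then have "(j, k, Suc a) \<in> I" using r by simp
    then show ?thesis using True step B_entry[OF q] by simp
  next
    case False
    then have a: "Suc a = degree p" using r by simp
    have "(mult_p ^^ Suc k) (x j) q = (if Suc k < \<alpha> ! j then B $$ (e q, e (j, Suc k, 0)) else 0)"
    proof (cases "Suc k < \<alpha> ! j")
      case True
      then have "(j, Suc k, 0) \<in> I" using r degree_pos by simp
      then show ?thesis using True B_entry[OF q] by simp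
    next
      case False
      then have "\<alpha> ! j = Suc k" using r by simp
      then show ?thesis using killed[OF q, of j] r by simp
    qed
    moreover have "(\<Sum>b<degree p. coeff p b * B $$ (e q, e (j, k, b)))
        = (\<Sum>b<degree p. coeff p b * (mult_x p ^^ b) ((mult_p ^^ k) (x j)) q)"
      using r q by (intro sum.cong) (simp_all add: B_entry)
    ultimately show ?thesis
      unfolding step a using poly_mult_x_cells[of "x j" k q, OF out] by simp
  qed
qed

text \<open>The entries of the generator columns that are not forced to vanish by \<open>p^(\<alpha> ! j)\<close>: a cell with
  \<open>k + \<alpha> ! j < \<alpha> ! i\<close> would be pushed to another cell of \<open>I\<close>. The subtraction is truncated, which is
  right for \<open>\<alpha> ! i \<le> \<alpha> ! j\<close>, where every \<open>k\<close> is allowed.\<close>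

definition free_entries :: "(nat \<times> nat) set" where
  "free_entries = (\<lambda>(j, i, k, a). (e (i, k, a), e (j, 0, 0))) `
     (SIGMA j:{..<length \<alpha>}. SIGMA i:{..<length \<alpha>}. {\<alpha> ! i - \<alpha> ! j..<\<alpha> ! i} \<times> {..<degree p})"

lemma free_entries_iff:
  "P \<in> free_entries \<longleftrightarrow> (\<exists>i k a j. P = (e (i, k, a), e (j, 0, 0)) \<and> (i, k, a) \<in> I \<and>
     (j, 0, 0) \<in> I \<and> \<alpha> ! i \<le> k + \<alpha> ! j)"
proof -
  have "(j, i, k, a) \<in> (SIGMA j:{..<length \<alpha>}. SIGMA i:{..<length \<alpha>}.
        {\<alpha> ! i - \<alpha> ! j..<\<alpha> ! i} \<times> {..<degree p})
      \<longleftrightarrow> (i, k, a) \<in> I \<and> (j, 0, 0) \<in> I \<and> \<alpha> ! i \<le> k + \<alpha> ! j" for j i k a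
    using degree_pos by auto
  then show ?thesis
    unfolding free_entries_def
    by (simp only: image_iff Bex_def split_paired_Ex prod.case) blast
qed

lemma card_free_entries:
  "card free_entries = degree p * (\<Sum>j<length \<alpha>. \<Sum>i<length \<alpha>. min (\<alpha> ! i) (\<alpha> ! j))"
proof -
  let ?S = "SIGMA j:{..<length \<alpha>}. SIGMA i:{..<length \<alpha>}. {\<alpha> ! i - \<alpha> ! j..<\<alpha> ! i} \<times> {..<degree p}"
  have "inj_on (\<lambda>(j, i, k, a). (e (i, k, a), e (j, 0, 0))) ?S"
    using degree_pos by (intro inj_onI) (auto simp: e_inj)
  then have "card free_entries = card ?S"
    unfolding free_entries_def by (rule card_image)
  also have "\<dots> = (\<Sum>j<length \<alpha>. \<Sum>i<length \<alpha>. min (\<alpha> ! i) (\<alpha> ! j) * degree p)"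
    by (auto simp: min_def intro!: sum.cong)
  finally show ?thesis by (simp add: sum_distrib_left mult.commute)
qed

lemma centralizer_eq_0:
  assumes B: "B \<in> mat_centralizer A" and "\<And>P. P \<in> free_entries \<Longrightarrow> B $$ P = 0"
  shows "B = 0\<^sub>m n n"
proof (rule eq_matI)
  have B_dim: "B \<in> carrier_mat n n" using B A_dim by (auto simp: mat_centralizer_def)
  show "dim_row B = dim_row (0\<^sub>m n n)" "dim_col B = dim_col (0\<^sub>m n n)" using B_dim by auto
  fix c d assume cd: "c < dim_row (0\<^sub>m n n)" "d < dim_col (0\<^sub>m n n)"
  then obtain q where q: "q \<in> I" "c = e q" using e_surj[of c] by auto
  from cd obtain j l b where r: "(j, l, b) \<in> I" "d = e (j, l, b)"
    using e_surj[of d] by (metis index_zero_mat(3) prod_cases3)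
  have j: "j < length \<alpha>" "0 < \<alpha> ! j" using r by auto
  have "B $$ (e u, e (j, 0, 0)) = 0" if "u \<in> I" for u
  proof (cases u)
    case u: (fields i k a)
    show ?thesis
    proof (cases "\<alpha> ! i \<le> k + \<alpha> ! j")
      case True
      then show ?thesis
        using that j degree_pos
        unfolding u by (intro assms(2), unfold free_entries_iff) (metis mem_cells)
    next
      case False
      then have "(i, k + \<alpha> ! j, a) \<in> I" using that by (simp add: u)
      \<comment> \<open>The value at \<open>u\<close> reappears in this cell after applying \<open>p^(\<alpha> ! j)\<close>.\<close>
      from centralizer_column(2)[OF B j this] that show ?thesis
        by (simp add: mult_p_pow u)
    qed
  qed
  then have x_0: "(\<lambda>u. if u \<in> I then B $$ (e u, e (j, 0, 0)) else 0) = (\<lambda>_. 0)"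
    by auto
  have "l < \<alpha> ! j" "b < degree p" using r by auto
  then have "B $$ (e q, e (j, l, b)) = 0"
    using centralizer_column(1)[OF B j q(1), of l b]
    unfolding x_0 by (simp add: mult_p_pow_0 mult_x_pow_0)
  then show "B $$ (c, d) = 0\<^sub>m n n $$ (c, d)"
    using cd q r by simp
qed

lemma centralizer_free:
  "\<exists>B\<in>mat_centralizer A. \<forall>P\<in>free_entries. B $$ P = f P"
proof -
  define x where "x j = (\<lambda>(i, k, a). if (i, k, a) \<in> I \<and> \<alpha> ! i \<le> k + \<alpha> ! j
      then f (e (i, k, a), e (j, 0, 0)) else 0)" for j
  define e' where "e' = inv_into I e"
  have e'_e: "e' (e q) = q" if "q \<in> I" for q
    using that e_bij by (simp add: e'_def bij_betw_def)
  define B where "B = mat n n (\<lambda>(c, d). case e' d of (j, k, a) \<Rightarrow>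
      (mult_x p ^^ a) ((mult_p ^^ k) (x j)) (e' c))"
  have B_dim: "B \<in> carrier_mat n n" by (simp add: B_def)
  have B_entry: "B $$ (e q, e (j, k, a)) = (mult_x p ^^ a) ((mult_p ^^ k) (x j)) q"
    if "q \<in> I" "(j, k, a) \<in> I" for q j k a
    using that e_less e'_e by (simp add: B_def del: mem_cells)
  have "B \<in> mat_centralizer A"
  proof (rule mem_centralizerI[OF _ _ B_dim B_entry])
    show "x j u = 0" if "u \<notin> I" for j u
      using that by (cases u) (auto simp: x_def)
    show "(mult_p ^^ (\<alpha> ! j)) (x j) q = 0" if "q \<in> I" for j q
      using that by (cases q) (auto simp: mult_p_pow x_def)
  qed
  moreover have "B $$ P = f P" if P_free: "P \<in> free_entries" for P
  proof -
    obtain i k a j where P: "P = (e (i, k, a), e (j, 0, 0))" "(i, k, a) \<in> I" "(j, 0, 0) \<in> I"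
        "\<alpha> ! i \<le> k + \<alpha> ! j"
      using P_free unfolding free_entries_iff by blast
    show ?thesis using P B_entry[OF P(2,3)] by (simp add: x_def)
  qed
  ultimately show ?thesis by blast
qed

lemma dim_centralizer_eq_sum_min:
  "dim_centralizer A = degree p * (\<Sum>j<length \<alpha>. \<Sum>i<length \<alpha>. min (\<alpha> ! i) (\<alpha> ! j))"
proof -
  have "free_entries \<subseteq> {..<n} \<times> {..<n}"
    using e_less by (auto simp only: free_entries_iff mem_Times_iff fst_conv snd_conv lessThan_iff)
  then have "vectorspace.dim (class_ring :: 'a ring)
      (module_mat TYPE('a) n n \<lparr>carrier := mat_centralizer A\<rparr>) = card free_entries"
    using mat_centralizer_subspace[OF A_dim] centralizer_eq_0 centralizer_free
    by (intro dim_eq_card_free_entries) auto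
  moreover have "dim_row A = n" using A_dim by simp
  ultimately show ?thesis by (simp add: dim_centralizer_def card_free_entries)
qed

end

section \<open>Indexing the generalized Jordan and Weyr matrices\<close>

lemma block_start_Cons [simp]: "block_start (n # ns) 0 = 0"
  "block_start (n # ns) (Suc k) = n + block_start ns k"
  by (simp_all add: block_start_def)

lemma block_start_less:
  assumes "k < length ns" "a < ns ! k"
  shows "block_start ns k + a < sum_list ns"
  using assms
proof (induction ns arbitrary: k)
  case (Cons n ns)
  then show ?case by (cases k) auto
qed simp

lemma block_start_inj:
  assumes "block_start ns k + a = block_start ns l + b"
    and "k < length ns" "a < ns ! k" "l < length ns" "b < ns ! l"
  shows "k = l \<and> a = b"
  using assms block_index_eq[of k ns a] block_index_eq[of l ns b] by auto

lemma block_start_replicate: "k \<le> t \<Longrightarrow> block_start (replicate t s) k = s * k"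
  by (simp add: block_start_def sum_list_replicate)

lemma diag_block_mat_index:
  assumes "\<And>M. M \<in> set Ms \<Longrightarrow> square_mat M" and "k < length Ms" "l < length Ms"
    and "a < dim_row (Ms ! k)" "b < dim_row (Ms ! l)"
  shows "diag_block_mat Ms $$ (block_start (map dim_row Ms) k + a, block_start (map dim_row Ms) l + b)
    = (if k = l then Ms ! k $$ (a, b) else 0)"
  using assms
proof (induction Ms arbitrary: k l)
  case (Cons M Ms)
  have dims: "dim_row (diag_block_mat Ms) = sum_list (map dim_row Ms)"
    "dim_col (diag_block_mat Ms) = sum_list (map dim_row Ms)"
    "dim_col M = dim_row M"
  proof -
    have cols: "map dim_col Ms = map dim_row Ms" using Cons.prems(1) by auto
    show "dim_row (diag_block_mat Ms) = sum_list (map dim_row Ms)"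
      "dim_col (diag_block_mat Ms) = sum_list (map dim_row Ms)"
      by (simp_all only: dim_diag_block_mat cols)
    show "dim_col M = dim_row M" using Cons.prems(1)[of M] by simp
  qed
  have less: "block_start (map dim_row Ms) i + c < sum_list (map dim_row Ms)"
    if "i < length Ms" "c < dim_row (Ms ! i)" for i c
    using block_start_less[of i "map dim_row Ms" c] that by simp
  show ?case
    using Cons.prems(2-) Cons.IH[of "k - 1" "l - 1"] Cons.prems(1) less
    by (cases k; cases l) (auto simp: Let_def dims add.assoc)
qed simp

lemma diag_block_mat_replicate_index:
  assumes "M \<in> carrier_mat s s" "k < t" "l < t" "a < s" "b < s"
  shows "diag_block_mat (replicate t M) $$ (s * k + a, s * l + b)
    = (if k = l then M $$ (a, b) else 0)"
  using assms diag_block_mat_index[of "replicate t M" k l a b]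
  by (auto simp: block_start_replicate)

lemma diag_block_mat_replicate_carrier:
  "M \<in> carrier_mat s s \<Longrightarrow> diag_block_mat (replicate t M) \<in> carrier_mat (s * t) (s * t)"
  by (intro carrier_matI) (simp_all add: dim_diag_block_mat sum_list_replicate mult.commute)

lemma append_rows_index:
  assumes "A \<in> carrier_mat n1 m" "B \<in> carrier_mat n2 m" "i < n1 + n2" "j < m"
  shows "(A @\<^sub>r B) $$ (i, j) = (if i < n1 then A $$ (i, j) else B $$ (i - n1, j))"
  using assms by (auto simp: append_rows_def)

lemma companion_mat_carrier [simp]: "companion_mat p \<in> carrier_mat (degree p) (degree p)"
  and corner_mat_carrier [simp]: "corner_mat s \<in> carrier_mat s s"
  by (simp_all add: companion_mat_def corner_mat_def)

lemma within_less:
  assumes "j < t" "a < s"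
  shows "s * j + a < s * (t :: nat)"
proof -
  have "s * j + a < s * Suc j" using assms by simp
  also have "\<dots> \<le> s * t" using assms by (intro mult_le_mono2) simp
  finally show ?thesis .
qed

lemma within_inj:
  assumes "s * j + a = s * i + b" "a < s" "b < (s :: nat)"
  shows "j = i \<and> a = b"
proof -
  have "(s * j + a) div s = j" "(s * i + b) div s = i" using assms(2,3) by simp_all
  then show ?thesis using assms by simp
qed

lemma bij_betw_cells:
  assumes "inj_on e (cells s \<alpha>)" "e ` cells s \<alpha> \<subseteq> {..<s * sum_list \<alpha>}"
  shows "bij_betw e (cells s \<alpha>) {..<s * sum_list \<alpha>}"
  using assms card_cells[of s \<alpha>] card_image[OF assms(1)]
  by (simp add: bij_betw_def card_subset_eq)

lemma gen_jordan_block_index: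
  fixes p :: "'a :: field poly"
  assumes "k < t" "l < t" "a < degree p" "b < degree p"
  shows "gen_jordan_block p t $$ (degree p * k + a, degree p * l + b)
    = gen_jordan_entry p (i, k, a) (i, l, b)"
proof -
  have "block_mat (replicate t (degree p)) B $$ (degree p * k + a, degree p * l + b) = B k l $$ (a, b)"
    for B :: "nat \<Rightarrow> nat \<Rightarrow> 'a mat"
    using block_mat_index[of k "replicate t (degree p)" l a b B] assms
    by (simp add: block_start_replicate)
  note block = this
  show ?thesis
    unfolding gen_jordan_block_def block gen_jordan_entry_def prod.case
    using assms by simp
qed

lemma gen_jordan_block_carrier [simp]:
  "gen_jordan_block p t \<in> carrier_mat (degree p * t) (degree p * t)"
  by (simp add: gen_jordan_block_def block_mat_def sum_list_replicate mult.commute)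

lemma gen_jordan_mat_indexed:
  assumes "lead_coeff p = 1" "0 < degree p"
  shows "gen_jordan_indexed p \<alpha> (gen_jordan_mat p \<alpha>)
    (\<lambda>(j, k, a). block_start (map (\<lambda>t. degree p * t) \<alpha>) j + (degree p * k + a))"
    (is "gen_jordan_indexed _ _ _ ?e")
proof unfold_locales
  let ?s = "degree p" and ?ns = "map (\<lambda>t. degree p * t) \<alpha>"
  show "lead_coeff p = 1" "0 < degree p" by fact+
  show "gen_jordan_mat p \<alpha> \<in> carrier_mat (?s * sum_list \<alpha>) (?s * sum_list \<alpha>)"
    by (rule gen_jordan_mat_square)
  show "bij_betw ?e (cells ?s \<alpha>) {..<?s * sum_list \<alpha>}"
  proof (rule bij_betw_cells)
    show "?e ` cells ?s \<alpha> \<subseteq> {..<?s * sum_list \<alpha>}"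
      using block_start_less[of _ ?ns] by (auto simp: within_less sum_list_const_mult)
    show "inj_on ?e (cells ?s \<alpha>)"
    proof (rule inj_onI)
      fix q r assume qr: "q \<in> cells ?s \<alpha>" "r \<in> cells ?s \<alpha>" "?e q = ?e r"
      obtain j k a i l b where q: "q = (j, k, a)" and r: "r = (i, l, b)" by (metis prod_cases3)
      have eq: "block_start ?ns j + (?s * k + a) = block_start ?ns i + (?s * l + b)"
        using qr(3) by (simp add: q r)
      have cells: "j < length \<alpha>" "k < \<alpha> ! j" "a < ?s" "i < length \<alpha>" "l < \<alpha> ! i" "b < ?s"
        using qr by (auto simp: q r)
      then have "j = i \<and> ?s * k + a = ?s * l + b"
        by (intro block_start_inj[OF eq]) (simp_all add: within_less)
      then show "q = r" using within_inj[of ?s k a l b] cells by (simp add: q r)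
    qed
  qed
  fix q r assume qr: "q \<in> cells ?s \<alpha>" "r \<in> cells ?s \<alpha>"
  obtain j k a i l b where q: "q = (j, k, a)" and r: "r = (i, l, b)" by (metis prod_cases3)
  have ns: "map dim_row (map (gen_jordan_block p) \<alpha>) = ?ns"
    by (simp add: carrier_matD[OF gen_jordan_block_carrier])
  have cells: "j < length \<alpha>" "k < \<alpha> ! j" "a < ?s" "i < length \<alpha>" "l < \<alpha> ! i" "b < ?s"
    using qr by (auto simp: q r)
  show "gen_jordan_mat p \<alpha> $$ (?e q, ?e r) = gen_jordan_entry p q r"
  proof -
    have "?s * k + a < dim_row (gen_jordan_block p (\<alpha> ! j))"
      "?s * l + b < dim_row (gen_jordan_block p (\<alpha> ! i))"
      using cells by (simp_all add: carrier_matD[OF gen_jordan_block_carrier] within_less)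
    moreover have "square_mat M" if "M \<in> set (map (gen_jordan_block p) \<alpha>)" for M
      using that by (auto simp: carrier_matD[OF gen_jordan_block_carrier])
    ultimately have "gen_jordan_mat p \<alpha> $$ (?e q, ?e r)
        = (if j = i then gen_jordan_block p (\<alpha> ! j) $$ (?s * k + a, ?s * l + b) else 0)"
      using cells
        diag_block_mat_index[of "map (gen_jordan_block p) \<alpha>" j i "?s * k + a" "?s * l + b"]
      unfolding ns gen_jordan_mat_def q r by simp
    also have "\<dots> = gen_jordan_entry p q r"
    proof (cases "j = i")
      case True
      then show ?thesis
        using gen_jordan_block_index[of k "\<alpha> ! j" l a p b j] cells by (simp add: q r)
    next
      case False
      then show ?thesis by (simp add: q r gen_jordan_entry_def)
    qed
    finally show ?thesis .
  qed
qed

lemma downward_closed_eq_lessThan_card: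
  fixes S :: "nat set"
  assumes "finite S" and down: "\<And>i j. j \<in> S \<Longrightarrow> i \<le> j \<Longrightarrow> i \<in> S"
  shows "S = {..<card S}"
proof (intro Set.set_eqI iffI)
  fix j assume "j \<in> S"
  then have "{..j} \<subseteq> S" using down by auto
  then have "card {..j} \<le> card S" using assms(1) card_mono by blast
  then show "j \<in> {..<card S}" by simp
next
  fix j assume j: "j \<in> {..<card S}"
  show "j \<in> S"
  proof (rule ccontr)
    assume "j \<notin> S"
    then have "S \<subseteq> {..<j}" using down by (metis lessThan_iff not_le subsetI)
    then have "card S \<le> j" using card_mono[of "{..<j}" S] by simp
    with j show False by simp
  qed
qed

lemma length_conj_partition [simp]: "length (conj_partition \<alpha>) = hd \<alpha>"
  by (simp add: conj_partition_def)

lemma conj_partition_nth: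
  "k < hd \<alpha> \<Longrightarrow> conj_partition \<alpha> ! k = card {j. j < length \<alpha> \<and> k < \<alpha> ! j}"
  by (simp add: conj_partition_def Suc_le_eq del: upt_Suc)

lemma gen_segre_char_nth_mono:
  "gen_segre_char \<alpha> \<Longrightarrow> i \<le> j \<Longrightarrow> j < length \<alpha> \<Longrightarrow> \<alpha> ! j \<le> \<alpha> ! i"
  unfolding gen_segre_char_def by (metis le_neq_implies_less order_refl sorted_wrt_iff_nth_less)

lemma gen_segre_char_nth_le_hd:
  "gen_segre_char \<alpha> \<Longrightarrow> j < length \<alpha> \<Longrightarrow> \<alpha> ! j \<le> hd \<alpha>"
  using gen_segre_char_nth_mono[of \<alpha> 0 j] by (simp add: gen_segre_char_def hd_conv_nth)

lemma less_conj_partition_nth_iff: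
  assumes "gen_segre_char \<alpha>" "k < hd \<alpha>"
  shows "j < conj_partition \<alpha> ! k \<longleftrightarrow> j < length \<alpha> \<and> k < \<alpha> ! j"
proof -
  have "{j. j < length \<alpha> \<and> k < \<alpha> ! j} = {..<conj_partition \<alpha> ! k}"
    unfolding conj_partition_nth[OF assms(2)]
    by (rule downward_closed_eq_lessThan_card)
       (use gen_segre_char_nth_mono[OF assms(1)] in \<open>auto simp: less_le_trans\<close>)
  then show ?thesis by auto
qed

lemma conj_partition_nth_eq_sum:
  "k < hd \<alpha> \<Longrightarrow> conj_partition \<alpha> ! k = (\<Sum>j<length \<alpha>. of_bool (k < \<alpha> ! j))"
  by (simp add: conj_partition_nth sum.If_cases of_bool_def lessThan_def Int_def)

lemma sum_of_bool_less: "m \<le> (n :: nat) \<Longrightarrow> (\<Sum>k<n. of_bool (k < m)) = m"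
proof -
  assume "m \<le> n"
  then have "{..<n} \<inter> {k. k < m} = {..<m}" by auto
  then show ?thesis by (simp add: sum.If_cases of_bool_def)
qed

lemma sum_list_conj_partition:
  assumes "gen_segre_char \<alpha>"
  shows "sum_list (conj_partition \<alpha>) = sum_list \<alpha>"
proof -
  have "sum_list (conj_partition \<alpha>) = (\<Sum>k<hd \<alpha>. \<Sum>j<length \<alpha>. of_bool (k < \<alpha> ! j))"
    by (simp add: sum_list_sum_nth atLeast0LessThan conj_partition_nth_eq_sum)
  also have "\<dots> = (\<Sum>j<length \<alpha>. \<Sum>k<hd \<alpha>. of_bool (k < \<alpha> ! j))"
    by (rule sum.swap)
  also have "\<dots> = (\<Sum>j<length \<alpha>. \<alpha> ! j)"
    using gen_segre_char_nth_le_hd[OF assms] by (intro sum.cong sum_of_bool_less) auto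
  finally show ?thesis by (simp add: sum_list_sum_nth atLeast0LessThan)
qed

text \<open>The chain \<open>p^(\<alpha> ! j - 1), \<dots>, p, 1\<close> of summand \<open>j\<close> is read backwards: the cell \<open>(j, k, a)\<close> goes into
  copy \<open>j\<close> of block \<open>\<alpha> ! j - 1 - k\<close>, so that raising \<open>k\<close> means moving one block up, which turns the
  subdiagonal corner blocks into superdiagonal ones. Because \<open>\<alpha>\<close> is nonincreasing, the summands that
  reach block \<open>y\<close> are exactly the first \<open>\<tau> ! y\<close> ones, so that the copies in a block are numbered
  without gaps.\<close>

lemma gen_weyr_mat_indexed:
  assumes "lead_coeff p = 1" "0 < degree p" and \<alpha>: "gen_segre_char \<alpha>"
  shows "gen_jordan_indexed p \<alpha> (gen_weyr_mat p \<alpha>)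
    (\<lambda>(j, k, a). block_start (map (\<lambda>t. degree p * t) (conj_partition \<alpha>)) (\<alpha> ! j - 1 - k)
      + (degree p * j + a))"
    (is "gen_jordan_indexed _ _ _ ?e")
proof unfold_locales
  let ?s = "degree p" and ?\<tau> = "conj_partition \<alpha>"
  let ?ns = "map (\<lambda>t. ?s * t) ?\<tau>"
  show "lead_coeff p = 1" "0 < degree p" by fact+
  show "gen_weyr_mat p \<alpha> \<in> carrier_mat (?s * sum_list \<alpha>) (?s * sum_list \<alpha>)"
    using gen_weyr_mat_square[of p \<alpha>] by (simp add: sum_list_conj_partition \<alpha>)
  have level: "\<alpha> ! j - 1 - k < hd \<alpha>" "j < ?\<tau> ! (\<alpha> ! j - 1 - k)"
    if "j < length \<alpha>" "k < \<alpha> ! j" for j k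
  proof -
    show *: "\<alpha> ! j - 1 - k < hd \<alpha>"
      using gen_segre_char_nth_le_hd[OF \<alpha>, of j] that by linarith
    show "j < ?\<tau> ! (\<alpha> ! j - 1 - k)"
      using less_conj_partition_nth_iff[OF \<alpha> *, of j] that by linarith
  qed
  show "bij_betw ?e (cells ?s \<alpha>) {..<?s * sum_list \<alpha>}"
  proof (rule bij_betw_cells)
    have "?e (j, k, a) < sum_list ?ns" if "(j, k, a) \<in> cells ?s \<alpha>" for j k a
      using that block_start_less[of "\<alpha> ! j - 1 - k" ?ns] level[of j k] by (simp add: within_less)
    then show "?e ` cells ?s \<alpha> \<subseteq> {..<?s * sum_list \<alpha>}"
      by (auto simp: sum_list_const_mult sum_list_conj_partition \<alpha>)
    show "inj_on ?e (cells ?s \<alpha>)"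
    proof (rule inj_onI)
      fix q r assume qr: "q \<in> cells ?s \<alpha>" "r \<in> cells ?s \<alpha>" "?e q = ?e r"
      obtain j k a i l b where q: "q = (j, k, a)" and r: "r = (i, l, b)" by (metis prod_cases3)
      have eq: "block_start ?ns (\<alpha> ! j - 1 - k) + (?s * j + a)
          = block_start ?ns (\<alpha> ! i - 1 - l) + (?s * i + b)"
        using qr(3) by (simp add: q r)
      have cells: "j < length \<alpha>" "k < \<alpha> ! j" "a < ?s" "i < length \<alpha>" "l < \<alpha> ! i" "b < ?s"
        using qr by (auto simp: q r)
      then have *: "\<alpha> ! j - 1 - k = \<alpha> ! i - 1 - l \<and> ?s * j + a = ?s * i + b"
        using level[of j k] level[of i l]
        by (intro block_start_inj[OF eq]) (simp_all add: within_less)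
      then have "j = i" "a = b" using within_inj[of ?s j a i b] cells by simp_all
      moreover from this have "k = l" using * cells by auto
      ultimately show "q = r" by (simp add: q r)
    qed
  qed
  fix q r assume qr: "q \<in> cells ?s \<alpha>" "r \<in> cells ?s \<alpha>"
  obtain j k a i l b where q: "q = (j, k, a)" and r: "r = (i, l, b)" by (metis prod_cases3)
  have cells: "j < length \<alpha>" "k < \<alpha> ! j" "a < ?s" "i < length \<alpha>" "l < \<alpha> ! i" "b < ?s"
    using qr by (auto simp: q r)
  define x where "x = \<alpha> ! j - 1 - k"
  define y where "y = \<alpha> ! i - 1 - l"
  have x: "x < hd \<alpha>" "j < ?\<tau> ! x" and y: "y < hd \<alpha>" "i < ?\<tau> ! y"
    using level cells by (auto simp: x_def y_def)
  have "gen_weyr_mat p \<alpha> $$ (?e q, ?e r) =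
    (if x = y then diag_block_mat (replicate (?\<tau> ! x) (companion_mat p))
     else if y = Suc x then
       diag_block_mat (replicate (?\<tau> ! y) (corner_mat ?s))
         @\<^sub>r 0\<^sub>m (?s * (?\<tau> ! x) - ?s * (?\<tau> ! y)) (?s * (?\<tau> ! y))
     else 0\<^sub>m (?s * (?\<tau> ! x)) (?s * (?\<tau> ! y))) $$ (?s * j + a, ?s * i + b)"
    unfolding gen_weyr_mat_def Let_def q r prod.case x_def[symmetric] y_def[symmetric]
    using x y cells by (subst block_mat_index) (simp_all add: within_less)
  also have "\<dots> = gen_jordan_entry p q r"
  proof -
    consider (eq) "x = y" | (below) "y = Suc x" | (other) "x \<noteq> y" "y \<noteq> Suc x" by blast
    then show ?thesis
    proof cases
      case eq
      then have "j = i \<Longrightarrow> k = l" using cells by (simp add: x_def y_def)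
      then show ?thesis
        using eq x y cells
        by (auto simp: diag_block_mat_replicate_index gen_jordan_entry_def q r)
    next
      case below
      have kl: "j = i \<longleftrightarrow> k = Suc l \<and> j = i" using below cells by (auto simp: x_def y_def)
      let ?D = "diag_block_mat (replicate (?\<tau> ! y) (corner_mat ?s :: 'a mat))"
      have D: "?D \<in> carrier_mat (?s * ?\<tau> ! y) (?s * ?\<tau> ! y)"
        by (rule diag_block_mat_replicate_carrier) simp
      have i: "?s * i + b < ?s * ?\<tau> ! y" and j: "?s * j + a < ?s * ?\<tau> ! x"
        using x y cells by (simp_all add: within_less)
      let ?Z = "0\<^sub>m (?s * (?\<tau> ! x) - ?s * (?\<tau> ! y)) (?s * (?\<tau> ! y)) :: 'a mat"
      have stack: "(?D @\<^sub>r ?Z) $$ (?s * j + a, ?s * i + b) =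
        (if ?s * j + a < ?s * ?\<tau> ! y then ?D $$ (?s * j + a, ?s * i + b)
         else ?Z $$ (?s * j + a - ?s * ?\<tau> ! y, ?s * i + b))"
        using i j by (intro append_rows_index[OF D zero_carrier_mat]) linarith+
      show ?thesis
      proof (cases "j < ?\<tau> ! y")
        case True
        then have "?s * j + a < ?s * ?\<tau> ! y" using cells by (simp add: within_less)
        moreover have "gen_jordan_entry p q r = (if j = i then corner_mat ?s $$ (a, b) else 0)"
          using kl by (auto simp: gen_jordan_entry_def q r)
        ultimately show ?thesis
          using below True y cells
            diag_block_mat_replicate_index[of "corner_mat ?s :: 'a mat" ?s j "?\<tau> ! y" i a b]
          by (simp add: stack[unfolded below])
      next
        case False
        then have "?s * ?\<tau> ! y \<le> ?s * j" by simp
        then have "\<not> ?s * j + a < ?s * ?\<tau> ! y" by linarith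
        moreover have "gen_jordan_entry p q r = 0"
          using False y(2) by (auto simp: gen_jordan_entry_def q r)
        ultimately show ?thesis
          using below i j by (simp add: stack[unfolded below])
      qed
    next
      case other
      then have "j = i \<Longrightarrow> k \<noteq> l \<and> k \<noteq> Suc l" using cells by (auto simp: x_def y_def)
      then show ?thesis
        using other x y cells
        by (auto simp: gen_jordan_entry_def q r within_less)
    qed
  qed
  finally show "gen_weyr_mat p \<alpha> $$ (?e q, ?e r) = gen_jordan_entry p q r" .
qed

section \<open>Summing the minima\<close>

text \<open>A new smallest part \<open>x\<close> is the minimum in the \<open>2 * n + 1\<close> new pairs.\<close>

lemma sum_min_eq_weighted_sum:
  assumes "sorted_wrt (\<ge>) \<alpha>"
  shows "(\<Sum>j<length \<alpha>. \<Sum>i<length \<alpha>. min (\<alpha> ! i) (\<alpha> ! j))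
    = (\<Sum>i<length \<alpha>. (2 * i + 1) * \<alpha> ! i)"
  using assms
proof (induction \<alpha> rule: rev_induct)
  case (snoc x \<alpha>)
  let ?n = "length \<alpha>"
  have x: "x \<le> \<alpha> ! i" if "i < ?n" for i
    using snoc.prems that by (auto simp: sorted_wrt_append)
  have "(\<Sum>j<?n. min x (\<alpha> ! j)) = ?n * x" "(\<Sum>i<?n. min (\<alpha> ! i) x) = ?n * x"
    using x by (simp_all add: min_absorb1 min_absorb2)
  then show ?case
    using snoc by (simp add: nth_append sum.distrib sorted_wrt_append algebra_simps)
qed simp

text \<open>The minimum of two parts counts the layers \<open>k\<close> below both, and \<open>(\<tau> ! k)\<^sup>2\<close> is the number of pairs
  of parts that exceed \<open>k\<close>.\<close>

lemma sum_min_eq_sum_conj_partition_squares: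
  assumes "gen_segre_char \<alpha>"
  shows "(\<Sum>j<length \<alpha>. \<Sum>i<length \<alpha>. min (\<alpha> ! i) (\<alpha> ! j))
    = (\<Sum>k<hd \<alpha>. (conj_partition \<alpha> ! k)\<^sup>2)"
proof -
  let ?b = "\<lambda>k j. of_bool (k < \<alpha> ! j) :: nat"
  have "(\<Sum>j<length \<alpha>. \<Sum>i<length \<alpha>. min (\<alpha> ! i) (\<alpha> ! j))
      = (\<Sum>j<length \<alpha>. \<Sum>i<length \<alpha>. \<Sum>k<hd \<alpha>. ?b k j * ?b k i)"
  proof (intro sum.cong refl)
    fix i j assume "i \<in> {..<length \<alpha>}" "j \<in> {..<length \<alpha>}"
    then have "min (\<alpha> ! i) (\<alpha> ! j) \<le> hd \<alpha>"
      using gen_segre_char_nth_le_hd[OF assms, of i] by auto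
    from sum_of_bool_less[OF this]
    show "min (\<alpha> ! i) (\<alpha> ! j) = (\<Sum>k<hd \<alpha>. ?b k j * ?b k i)"
      by (simp add: of_bool_conj mult.commute)
  qed
  also have "\<dots> = (\<Sum>j<length \<alpha>. \<Sum>k<hd \<alpha>. \<Sum>i<length \<alpha>. ?b k j * ?b k i)"
    by (intro sum.cong refl sum.swap)
  also have "\<dots> = (\<Sum>k<hd \<alpha>. \<Sum>j<length \<alpha>. \<Sum>i<length \<alpha>. ?b k j * ?b k i)"
    by (rule sum.swap)
  also have "\<dots> = (\<Sum>k<hd \<alpha>. (conj_partition \<alpha> ! k)\<^sup>2)"
    by (intro sum.cong)
       (simp_all only: conj_partition_nth_eq_sum lessThan_iff power2_eq_square sum_product)
  finally show ?thesis .
qed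

section \<open>The dimension formula\<close>

theorem mainTheorem5:
  fixes p :: "'a :: field poly" and s :: nat and \<alpha> \<tau> :: "nat list"
  assumes "lead_coeff p = 1" and "irreducible p" and "degree p = s"
    and "gen_segre_char \<alpha>" and "\<tau> = conj_partition \<alpha>"
  shows "dim_centralizer (gen_jordan_mat p \<alpha>) = s * (\<Sum>i = 1..length \<alpha>. (2 * i - 1) * \<alpha> ! (i - 1)) \<and>
    s * (\<Sum>i = 1..length \<alpha>. (2 * i - 1) * \<alpha> ! (i - 1)) = dim_centralizer (gen_weyr_mat p \<alpha>) \<and>
    dim_centralizer (gen_weyr_mat p \<alpha>) = s * (\<Sum>i = 1..hd \<alpha>. (\<tau> ! (i - 1))\<^sup>2)"
proof -
  have pos: "0 < degree p"
  proof (rule ccontr)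
    assume "\<not> 0 < degree p"
    moreover have "p \<noteq> 0" using assms(1) by auto
    ultimately have "is_unit p" by (simp add: is_unit_iff_degree)
    with \<open>irreducible p\<close> show False by (simp add: irreducible_not_unit)
  qed
  interpret G: gen_jordan_indexed p \<alpha> "gen_jordan_mat p \<alpha>"
      "\<lambda>(j, k, a). block_start (map (\<lambda>t. degree p * t) \<alpha>) j + (degree p * k + a)"
    by (rule gen_jordan_mat_indexed) fact+
  interpret W: gen_jordan_indexed p \<alpha> "gen_weyr_mat p \<alpha>"
      "\<lambda>(j, k, a). block_start (map (\<lambda>t. degree p * t) (conj_partition \<alpha>)) (\<alpha> ! j - 1 - k)
        + (degree p * j + a)"
    by (rule gen_weyr_mat_indexed) fact+
  have "sorted_wrt (\<ge>) \<alpha>" using assms(4) by (simp add: gen_segre_char_def)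
  then show ?thesis
    using G.dim_centralizer_eq_sum_min W.dim_centralizer_eq_sum_min sum_min_eq_sum_conj_partition_squares[OF assms(4)]
    by (simp add: assms(3,5) sum_min_eq_weighted_sum sum.atLeast1_atMost_eq)
qed

end
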